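(* Let $n\ge 4$ be even and $b$ odd with $3<b<n-2$, and suppose $\gcd(b-1,n)=2$ and $(b-1)^2/2\equiv 2\pmod n$. Then $\mathcal{M}_O(n,1,b)$ is $\mathcal{F}(1,2)$-invariant if and only if it is not the case that both $n\equiv 0\pmod 8$ and $b=(n+6)/2$.
   Context: $\mathcal{M}_O(n,a,b)$ has vertices $u_0,\dots,u_{n-1},v_0,\dots,v_{n-1}$ and edges $[u_i,u_{i+1}]$, $[u_i,v_i]$ for all $i$ and $[v_i,v_{i+a}]$, $[v_i,v_{i+b}]$ for even $i$ (subscripts mod $n$). A vertex-transitive graph $X$ is $\mathcal{F}(1,2)$-invariant if it admits a partition of $E(X)$ into a $1$-factor and a $2$-factor such that every automorphism of $X$ maps each of the two factors onto itself.
   Formalization: F(1,2)-invariant here also requires the 2-factor to consist of exactly two cycles; without this the claim fails, e.g. for M_O(16,1,11), where the 4-cycles form an invariant 2-factor and the remaining edges an invariant 1-factor. *)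

theory Defs
  imports "HOL-Number_Theory.Cong"
begin

text \<open>A graph is a pair of a vertex set and a set of undirected edges, an edge being the set
  of its two ends.\<close>

type_synonym 'a ugraph = "'a set \<times> 'a set set"

definition automorphism :: "'a ugraph \<Rightarrow> ('a \<Rightarrow> 'a) \<Rightarrow> bool" where
  "automorphism X f \<longleftrightarrow> bij_betw f (fst X) (fst X) \<and>
     (\<forall>x\<in>fst X. \<forall>y\<in>fst X. {x, y} \<in> snd X \<longleftrightarrow> {f x, f y} \<in> snd X)"

definition vertex_transitive :: "'a ugraph \<Rightarrow> bool" where
  "vertex_transitive X \<longleftrightarrow>
     (\<forall>x\<in>fst X. \<forall>y\<in>fst X. \<exists>f. automorphism X f \<and> f x = y)"

text \<open>A factor (spanning regular subgraph) is represented by its edge set.\<close>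

definition k_factor :: "nat \<Rightarrow> 'a ugraph \<Rightarrow> 'a set set \<Rightarrow> bool" where
  "k_factor k X F \<longleftrightarrow> F \<subseteq> snd X \<and> (\<forall>x\<in>fst X. card {e \<in> F. x \<in> e} = k)"

definition invariant_12_partition :: "'a ugraph \<Rightarrow> 'a set set \<Rightarrow> 'a set set \<Rightarrow> bool" where
  "invariant_12_partition X F1 F2 \<longleftrightarrow>
     k_factor 1 X F1 \<and> k_factor 2 X F2 \<and> F1 \<union> F2 = snd X \<and> F1 \<inter> F2 = {} \<and>
     (\<forall>f. automorphism X f \<longrightarrow> (`) f ` F1 = F1 \<and> (`) f ` F2 = F2)"

definition component :: "'a set set \<Rightarrow> 'a \<Rightarrow> 'a set" where
  "component F x = {y. (x, y) \<in> {(p, q). {p, q} \<in> F}\<^sup>*}"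

text \<open>The connected components of a finite 2-factor are cycles, so a 2-factor with exactly two
  components is one composed of two cycles.\<close>

definition composed_of_two_cycles :: "'a ugraph \<Rightarrow> 'a set set \<Rightarrow> bool" where
  "composed_of_two_cycles X F \<longleftrightarrow> k_factor 2 X F \<and> card (component F ` fst X) = 2"

text \<open>The 2-factor is required to be composed of two cycles. The clause is essential. In
  \<open>MO n 1 b\<close> (defined below), with \<open>n\<close> even, \<open>b\<close> odd, \<open>3 < b < n - 2\<close> and \<open>gcd (b - 1) n = 2\<close>,
  the only 4-cycles are \<open>u\<^sub>i u\<^sub>i\<^sub>+\<^sub>1 v\<^sub>i\<^sub>+\<^sub>1 v\<^sub>i\<close> with \<open>i\<close> even. They form a 2-factor which, like the
  complementary 1-factor, is preserved by every automorphism, so without the clause no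
  exceptional case could arise. For example, in \<open>MO 16 1 11\<close> the only invariant partition has
  this 2-factor, which consists of eight cycles.\<close>

definition F12_invariant :: "'a ugraph \<Rightarrow> bool" where
  "F12_invariant X \<longleftrightarrow> vertex_transitive X \<and>
     (\<exists>F1 F2. invariant_12_partition X F1 F2 \<and> composed_of_two_cycles X F2)"

datatype mo_vertex = U nat | V nat

text \<open>The parameters are of interest for \<open>n\<close> even and \<open>a\<close>, \<open>b\<close> odd and distinct modulo \<open>n\<close>,
  when the graph is simple and cubic.\<close>

definition MO :: "nat \<Rightarrow> nat \<Rightarrow> nat \<Rightarrow> mo_vertex ugraph" where
  "MO n a b =
    (U ` {..<n} \<union> V ` {..<n},
     {{U i, U ((i + 1) mod n)} | i. i < n} \<union>
     {{U i, V i} | i. i < n} \<union>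
     {{V i, V ((i + a) mod n)} | i. i < n \<and> even i} \<union>
     {{V i, V ((i + b) mod n)} | i. i < n \<and> even i})"

end

theory Submission
  imports Defs
begin

text \<open>The squares \<open>u\<^sub>i u\<^sub>i\<^sub>+\<^sub>1 v\<^sub>i\<^sub>+\<^sub>1 v\<^sub>i\<close> with \<open>i\<close> even are the only 4-cycles, so every automorphism
  permutes them, and each vertex has a spoke and a further edge in its square and one edge, its
  link, leading to another square. An automorphism commutes with taking the other end of the link
  and with taking the opposite corner of the square; it can only confuse the spoke with the other
  edge of the square. Start at a vertex and repeat twice: go to the opposite corner, cross the
  link, move along one edge of the square, cross the link. If both moves along an edge use the
  spoke, the walk closes up. If exactly one does, it ends on the other side of the spokes, and if
  none does, it ends at a vertex whose subscript has changed by \<open>2 (b - 3)\<close>. So unless \<open>n\<close> divides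
  \<open>2 (b - 3)\<close>, which is the exceptional case, all automorphisms preserve the spokes, and the
  spokes and the cycles of the \<open>u\<^sub>i\<close> and the \<open>v\<^sub>i\<close> are an invariant partition.

  In the exceptional case some automorphism fixes a vertex and exchanges the two edges of its
  square at that vertex. Then the invariant 1-factor can only consist of the links, and the
  complementary 2-factor consists of squares.\<close>

section \<open>Neighbours and edges over integer subscripts\<close>

locale mo_graph =
  fixes n b :: nat
  assumes even_n: "even n" and odd_b: "odd b" and b_gt: "3 < b" and b_less: "b < n - 2"
    and square_cong: "[(b - 1)\<^sup>2 div 2 = 2] (mod n)"
begin

abbreviation N :: int where "N \<equiv> int n"

text \<open>Subscripts are arbitrary integers read modulo \<open>n\<close>, so that shifts in both
  directions can be computed without reducing them.\<close>

definition u :: "int \<Rightarrow> mo_vertex" where "u i = U (nat (i mod N))"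

definition v :: "int \<Rightarrow> mo_vertex" where "v i = V (nat (i mod N))"

definition X :: "mo_vertex ugraph" where "X = MO n 1 b"

abbreviation W :: "mo_vertex set" where "W \<equiv> fst X"

abbreviation E :: "mo_vertex set set" where "E \<equiv> snd X"

text \<open>The maps \<open>spoke\<close>, \<open>side\<close> and \<open>link\<close> are
  involutions on \<open>W\<close> that list the three neighbours of a vertex; their edges are three
  perfect matchings that together make up \<open>E\<close>.\<close>

primrec spoke :: "mo_vertex \<Rightarrow> mo_vertex" where
  "spoke (U i) = V i"
| "spoke (V i) = U i"

primrec side :: "mo_vertex \<Rightarrow> mo_vertex" where
  "side (U i) = (if even i then u (int i + 1) else u (int i - 1))"
| "side (V i) = (if even i then v (int i + 1) else v (int i - 1))"

primrec link :: "mo_vertex \<Rightarrow> mo_vertex" where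
  "link (U i) = (if even i then u (int i - 1) else u (int i + 1))"
| "link (V i) = (if even i then v (int i + int b) else v (int i - int b))"

lemma n_gt: "n > 7"
  using b_gt b_less odd_b even_n by presburger

lemma u_eq_iff: "u i = u j \<longleftrightarrow> N dvd i - j"
  using n_gt by (auto simp: u_def mod_eq_dvd_iff eq_nat_nat_iff)

lemma v_eq_iff: "v i = v j \<longleftrightarrow> N dvd i - j"
  using n_gt by (auto simp: v_def mod_eq_dvd_iff eq_nat_nat_iff)

lemma u_neq_v [simp]: "u i \<noteq> v j" "v j \<noteq> u i"
  by (simp_all add: u_def v_def)

lemma u_of_nat: "i < n \<Longrightarrow> u (int i) = U i"
  by (simp add: u_def)

lemma v_of_nat: "i < n \<Longrightarrow> v (int i) = V i"
  by (simp add: v_def)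

lemma u_of_nat_mod: "u (int i) = U (i mod n)"
  by (simp add: u_def flip: zmod_int)

lemma v_of_nat_mod: "v (int i) = V (i mod n)"
  by (simp add: v_def flip: zmod_int)

text \<open>As \<open>n\<close> is even, a subscript modulo \<open>n\<close> still has a parity, on
  which \<open>side\<close> and \<open>link\<close> depend.\<close>

lemma even_nat_mod [simp]: "even (nat (i mod N)) \<longleftrightarrow> even i"
proof -
  have "even (nat (i mod N)) \<longleftrightarrow> even (i mod N)"
    using n_gt by (simp add: even_nat_iff)
  also have "\<dots> \<longleftrightarrow> even i"
    using even_n by (simp add: dvd_mod_iff)
  finally show ?thesis .
qed

lemma spoke_uv [simp]: "spoke (u i) = v i" "spoke (v i) = u i"
  by (simp_all add: u_def v_def)

lemma side_uv:
  "side (u i) = (if even i then u (i + 1) else u (i - 1))"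
  "side (v i) = (if even i then v (i + 1) else v (i - 1))"
  using n_gt by (simp_all add: u_def v_def mod_simps)

lemma link_uv:
  "link (u i) = (if even i then u (i - 1) else u (i + 1))"
  "link (v i) = (if even i then v (i + int b) else v (i - int b))"
  using n_gt by (simp_all add: u_def v_def mod_simps)

lemma W_eq: "W = range u \<union> range v"
proof -
  have "x \<in> range u" if "x \<in> U ` {..<n}" for x
    using that by (auto simp: image_iff simp flip: u_of_nat)
  moreover have "x \<in> range v" if "x \<in> V ` {..<n}" for x
    using that by (auto simp: image_iff simp flip: v_of_nat)
  moreover have "u i \<in> U ` {..<n}" "v i \<in> V ` {..<n}" for i
    using n_gt by (auto simp: u_def v_def nat_less_iff)
  ultimately show ?thesis
    by (auto simp: X_def MO_def)
qed

lemma uv_in_W [simp]: "u i \<in> W" "v i \<in> W"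
  by (auto simp: W_eq)

lemma W_cases [consumes 1, case_names u v]:
  assumes "x \<in> W"
  obtains i where "x = u i" | i where "x = v i"
  using assms by (auto simp: W_eq)

lemma u_nat_rep: obtains k where "k < n" "u i = u (int k)" "v i = v (int k)" "even k \<longleftrightarrow> even i"
proof
  show "nat (i mod N) < n"
    using n_gt by (simp add: nat_less_iff)
  show "u i = u (int (nat (i mod N)))" "v i = v (int (nat (i mod N)))"
    using n_gt by (simp_all add: u_def v_def)
qed simp

lemma E_eq:
  "E = range (\<lambda>i. {u i, u (i + 1)}) \<union> range (\<lambda>i. {u i, v i}) \<union>
    (\<lambda>i. {v i, v (i + 1)}) ` {i. even i} \<union> (\<lambda>i. {v i, v (i + int b)}) ` {i. even i}"
    (is "_ = ?A \<union> ?B \<union> ?C \<union> ?D")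
proof -
  have u_add: "u (i + c) = U ((k + nat c) mod n)" if "u i = u (int k)" "c \<ge> 0" for i c k
  proof -
    have "u (i + c) = u (int (k + nat c))"
      using that by (simp add: u_eq_iff)
    then show ?thesis by (simp only: u_of_nat_mod)
  qed
  have v_add: "v (i + c) = V ((k + nat c) mod n)" if "v i = v (int k)" "c \<ge> 0" for i c k
  proof -
    have "v (i + c) = v (int (k + nat c))"
      using that by (simp add: v_eq_iff)
    then show ?thesis by (simp only: v_of_nat_mod)
  qed
  have A: "?A = {{U i, U ((i + 1) mod n)} | i. i < n}"
  proof (intro equalityI subsetI)
    fix e assume "e \<in> ?A"
    then obtain i where e: "e = {u i, u (i + 1)}" by auto
    obtain k where "k < n" "u i = u (int k)" using u_nat_rep by metis
    then show "e \<in> {{U i, U ((i + 1) mod n)} | i. i < n}"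
      using e u_add[of i k 1] u_of_nat by auto
  next
    fix e assume "e \<in> {{U i, U ((i + 1) mod n)} | i. i < n}"
    then obtain k where "k < n" "e = {U k, U ((k + 1) mod n)}" by auto
    then have "e = {u (int k), u (int k + 1)}"
      using u_add[of "int k" k 1] u_of_nat by auto
    then show "e \<in> ?A" by auto
  qed
  have B: "?B = {{U i, V i} | i. i < n}"
  proof (intro equalityI subsetI)
    fix e assume "e \<in> ?B"
    then obtain i where e: "e = {u i, v i}" by auto
    obtain k where "k < n" "u i = u (int k)" "v i = v (int k)" using u_nat_rep by metis
    then show "e \<in> {{U i, V i} | i. i < n}"
      using e u_of_nat v_of_nat by auto
  next
    fix e assume "e \<in> {{U i, V i} | i. i < n}"
    then obtain k where "k < n" "e = {U k, V k}" by auto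
    then have "e = {u (int k), v (int k)}"
      using u_of_nat v_of_nat by auto
    then show "e \<in> ?B" by auto
  qed
  have CD: "(\<lambda>i. {v i, v (i + int c)}) ` {i. even i} =
      {{V i, V ((i + c) mod n)} | i. i < n \<and> even i}" (is "?l = ?r") for c
  proof (intro equalityI subsetI)
    fix e assume "e \<in> ?l"
    then obtain i where e: "e = {v i, v (i + int c)}" and "even i" by auto
    then obtain k where "k < n" "v i = v (int k)" "even k" using u_nat_rep by metis
    then show "e \<in> ?r"
      using e v_add[of i k "int c"] v_of_nat by auto
  next
    fix e assume "e \<in> ?r"
    then obtain k where k: "k < n" "even k" "e = {V k, V ((k + c) mod n)}" by auto
    then have "e = {v (int k), v (int k + int c)}"
      using v_add[of "int k" k "int c"] v_of_nat by auto
    then show "e \<in> ?l" using k(2) by auto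
  qed
  show ?thesis
    unfolding A B CD[of b] CD[of 1, simplified] by (simp add: X_def MO_def Un_assoc)
qed

lemma spoke_spoke [simp]: "x \<in> W \<Longrightarrow> spoke (spoke x) = x"
  by (auto elim: W_cases)

lemma side_side [simp]: "x \<in> W \<Longrightarrow> side (side x) = x"
  by (auto elim!: W_cases simp: side_uv)

lemma link_link [simp]: "x \<in> W \<Longrightarrow> link (link x) = x"
  using odd_b by (auto elim!: W_cases simp: link_uv)

lemma side_spoke: "x \<in> W \<Longrightarrow> side (spoke x) = spoke (side x)"
  by (auto elim!: W_cases simp: side_uv)

lemma mates_in_W [simp]:
  assumes "x \<in> W"
  shows "spoke x \<in> W" "side x \<in> W" "link x \<in> W"
  using assms by (auto elim!: W_cases simp: side_uv link_uv)

text \<open>This turns every question about adjacency into a choice among three named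
  neighbours.\<close>

lemma edge_iff: "{x, y} \<in> E \<longleftrightarrow> x \<in> W \<and> (y = spoke x \<or> y = side x \<or> y = link x)"
proof
  assume "{x, y} \<in> E"
  then show "x \<in> W \<and> (y = spoke x \<or> y = side x \<or> y = link x)"
    unfolding E_eq using odd_b by (auto simp: doubleton_eq_iff side_uv link_uv)
next
  have uu: "{u i, u (i + 1)} \<in> E" "{u i, v i} \<in> E" for i
    by (auto simp: E_eq)
  have vv: "{v i, v (i + 1)} \<in> E" "{v i, v (i + int b)} \<in> E" if "even i" for i
    using that by (auto simp: E_eq)
  assume *: "x \<in> W \<and> (y = spoke x \<or> y = side x \<or> y = link x)"
  then have "x \<in> W" by simp
  then show "{x, y} \<in> E"
  proof (cases rule: W_cases)
    case (u i)
    then show ?thesis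
      using * uu[of i] uu(1)[of "i - 1"] by (auto simp: side_uv link_uv insert_commute split: if_splits)
  next
    case (v i)
    then show ?thesis
      using * uu(2)[of i] vv[of i] vv(1)[of "i - 1"] vv(2)[of "i - int b"] odd_b
      by (auto simp: side_uv link_uv insert_commute split: if_splits)
  qed
qed

section \<open>Divisibility by \<open>n\<close> and the congruence on \<open>b\<close>\<close>

lemma ndvd: "k \<noteq> 0 \<Longrightarrow> \<bar>k\<bar> < N \<Longrightarrow> \<not> N dvd k"
  using dvd_imp_le_int[of k N] by linarith

lemma b_bounds: "3 < int b" "int b + 2 < N" "7 < N" "\<not> n dvd b"
  using b_gt b_less n_gt by (auto dest: dvd_imp_le)

text \<open>With s = (b - 1) / 2 the congruence on \<open>b\<close> becomes 2 s^2 = 2 modulo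
  \<open>n\<close>, the form in which it is used below.\<close>

lemma half_b: obtains s where "int b = 2 * s + 1" "s > 1" "N dvd 2 * s\<^sup>2 - 2"
proof
  define s where "s = (b - 1) div 2"
  have b: "b = 2 * s + 1" using odd_b unfolding s_def by presburger
  show "int b = 2 * int s + 1" "int s > 1" using b b_gt by auto
  have "(b - 1)\<^sup>2 div 2 = 2 * s\<^sup>2" by (simp add: b power2_eq_square)
  with square_cong have "[int (2 * s\<^sup>2) = int 2] (mod N)"
    unfolding cong_int_iff by simp
  then show "N dvd 2 * (int s)\<^sup>2 - 2" by (simp add: cong_iff_dvd_diff)
qed

text \<open>By size, divisibility would force n = 2 (b - 1) = 4 s. The congruence then makes s
  divide s^2 - 1, hence 1, contrary to s > 1. This excludes 4-cycles formed by the
  \<open>v i\<close> alone.\<close>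

lemma ndvd_double: "\<not> N dvd 2 * (int b - 1)"
proof
  assume dvd: "N dvd 2 * (int b - 1)"
  obtain s where s: "int b = 2 * s + 1" "s > 1" "N dvd 2 * s\<^sup>2 - 2" by (rule half_b)
  from dvd obtain k where k: "2 * (int b - 1) = N * k" ..
  have "0 < 2 * (int b - 1)" "2 * (int b - 1) < N * 2" using b_bounds by auto
  then have "0 < N * k" "N * k < N * 2" unfolding k .
  then have "k = 1" using n_gt by (simp add: zero_less_mult_iff mult_less_cancel_left)
  then have "4 * s dvd 2 * s\<^sup>2 - 2" using k s by simp
  then have "2 * s * 2 dvd (s\<^sup>2 - 1) * 2" by (simp add: algebra_simps)
  then have "2 * s dvd s\<^sup>2 - 1" by (subst (asm) dvd_mult_cancel_right) simp
  then have "s dvd s\<^sup>2 - 1" by (rule dvd_mult_right)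
  then obtain j where "s\<^sup>2 - 1 = s * j" ..
  then have "1 = s * (s - j)" by (simp add: algebra_simps power2_eq_square)
  then have "s dvd 1" ..
  then show False using s(2) by simp
qed

lemma ndvd_double': "\<not> N dvd 2 * (1 - int b)"
  using ndvd_double dvd_minus_iff[of N "2 * (int b - 1)"] by (simp add: algebra_simps)

lemma mates_distinct [simp]:
  assumes "x \<in> W"
  shows "side x \<noteq> spoke x" "spoke x \<noteq> side x" "link x \<noteq> spoke x" "spoke x \<noteq> link x"
    "link x \<noteq> side x" "side x \<noteq> link x" "spoke (side x) \<noteq> x"
    "spoke x \<noteq> x" "side x \<noteq> x" "link x \<noteq> x"
    "spoke (link x) \<noteq> x"
  using assms b_bounds
  by (auto elim!: W_cases simp: side_uv link_uv u_eq_iff v_eq_iff ndvd split: if_splits)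

lemma edge_mates [simp]: "x \<in> W \<Longrightarrow> {x, spoke x} \<in> E" "x \<in> W \<Longrightarrow> {x, side x} \<in> E"
    "x \<in> W \<Longrightarrow> {x, link x} \<in> E"
  by (simp_all add: edge_iff)

subsection \<open>Automorphisms and squares\<close>

text \<open>For adjacent \<open>x\<close> and \<open>y\<close> this says that their edge lies on a
  4-cycle. It is phrased by adjacency only, so automorphisms preserve it.\<close>

definition in_square :: "mo_vertex \<Rightarrow> mo_vertex \<Rightarrow> bool" where
  "in_square x y \<longleftrightarrow>
    (\<exists>w\<in>W. \<exists>z\<in>W. {x, w} \<in> E \<and> {w, z} \<in> E \<and> {z, y} \<in> E \<and> w \<noteq> y \<and> z \<noteq> x)"

lemma in_square_spoke:
  assumes "x \<in> W" shows "in_square x (spoke x)"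
  unfolding in_square_def using assms
  by (intro bexI[of _ "side x"] bexI[of _ "spoke (side x)"])
    (auto simp: edge_iff side_spoke)

lemma in_square_side:
  assumes "x \<in> W" shows "in_square x (side x)"
  unfolding in_square_def using assms
  by (intro bexI[of _ "spoke x"] bexI[of _ "spoke (side x)"])
    (auto simp: edge_iff side_spoke)

text \<open>A 4-cycle through a link would continue at both ends by a spoke or a side. Comparing
  subscripts, it closes only if \<open>n\<close> divides a nonzero number of absolute value below
  \<open>n\<close>, or 2 (b - 1) up to sign.\<close>

lemma not_in_square_link:
  assumes "x \<in> W" shows "\<not> in_square x (link x)"
proof
  assume "in_square x (link x)"
  then obtain w z where wz: "w \<in> W" "z \<in> W" "{x, w} \<in> E" "{w, z} \<in> E" "{z, link x} \<in> E"
    "w \<noteq> link x" "z \<noteq> x" unfolding in_square_def by blast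
  have w: "w = spoke x \<or> w = side x" using wz by (auto simp: edge_iff)
  have "{link x, z} \<in> E" using wz(5) by (simp add: insert_commute)
  then have z: "z = spoke (link x) \<or> z = side (link x)"
    using wz(7) assms by (auto simp: edge_iff)
  have z': "z = link w \<or> z = spoke w \<or> z = side w" using wz(4) by (auto simp: edge_iff)
  from assms show False
  proof (cases rule: W_cases)
    case (u i)
    show False
      using w z z' b_bounds odd_b
      by (cases "even i") (auto simp: u side_uv link_uv u_eq_iff v_eq_iff ndvd split: if_splits)
  next
    case (v i)
    show False
      using w z z' b_bounds odd_b ndvd_double ndvd_double'
      by (cases "even i") (auto simp: v side_uv link_uv u_eq_iff v_eq_iff ndvd split: if_splits)
  qed
qed

lemma automorphism_in_W: "automorphism X f \<Longrightarrow> x \<in> W \<Longrightarrow> f x \<in> W"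
  by (auto simp: automorphism_def dest: bij_betwE)

lemma automorphism_edge:
  "automorphism X f \<Longrightarrow> x \<in> W \<Longrightarrow> y \<in> W \<Longrightarrow> {f x, f y} \<in> E \<longleftrightarrow> {x, y} \<in> E"
  by (auto simp: automorphism_def)

lemma automorphism_inj:
  "automorphism X f \<Longrightarrow> x \<in> W \<Longrightarrow> y \<in> W \<Longrightarrow> f x = f y \<longleftrightarrow> x = y"
  by (auto simp: automorphism_def bij_betw_def dest: inj_onD)

lemma automorphism_comp:
  "automorphism X f \<Longrightarrow> automorphism X g \<Longrightarrow> automorphism X (g \<circ> f)"
  by (auto simp: automorphism_def intro: bij_betw_trans dest: bij_betwE)

lemma in_square_automorphism:
  assumes f: "automorphism X f" and xy: "x \<in> W" "y \<in> W" and "in_square x y"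
  shows "in_square (f x) (f y)"
proof -
  obtain w z where wz: "w \<in> W" "z \<in> W" "{x, w} \<in> E" "{w, z} \<in> E" "{z, y} \<in> E"
    "w \<noteq> y" "z \<noteq> x"
    using assms(4) unfolding in_square_def by blast
  then show ?thesis
    unfolding in_square_def using xy f
    by (intro bexI[of _ "f w"] bexI[of _ "f z"])
      (auto simp: automorphism_edge automorphism_inj automorphism_in_W)
qed

text \<open>Spokes and sides are exactly the edges on 4-cycles, so they cannot be mapped to
  links.\<close>

lemma automorphism_square:
  assumes f: "automorphism X f" and x: "x \<in> W"
  shows "f (spoke x) \<in> {spoke (f x), side (f x)}" "f (side x) \<in> {spoke (f x), side (f x)}"
proof -
  have *: "f y \<in> {spoke (f x), side (f x)}" if "y \<in> W" "in_square x y" "{x, y} \<in> E" for y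
  proof -
    have "in_square (f x) (f y)" using in_square_automorphism f x that by blast
    then have "f y \<noteq> link (f x)"
      using not_in_square_link[OF automorphism_in_W[OF f x]] by auto
    moreover have "{f x, f y} \<in> E" using automorphism_edge f x that by blast
    ultimately show ?thesis by (auto simp: edge_iff)
  qed
  show "f (spoke x) \<in> {spoke (f x), side (f x)}" "f (side x) \<in> {spoke (f x), side (f x)}"
    by (intro *; simp add: x in_square_spoke in_square_side)+
qed

lemma automorphism_link:
  assumes f: "automorphism X f" and x: "x \<in> W"
  shows "f (link x) = link (f x)"
proof -
  have "{f x, f (link x)} \<in> E" using f x by (simp add: automorphism_edge)
  moreover have "f (spoke x) \<noteq> f (side x)" "f (link x) \<noteq> f (side x)" "f (link x) \<noteq> f (spoke x)"
    using f x by (simp_all add: automorphism_inj)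
  ultimately show ?thesis
    using automorphism_square[OF f x] by (auto simp: edge_iff)
qed

text \<open>If \<open>f\<close> confuses spoke and side at \<open>x\<close>, this does not matter
  here: the opposite corner is reached through either neighbour, and injectivity rules out returning
  to \<open>f x\<close>.\<close>

lemma automorphism_opposite:
  assumes f: "automorphism X f" and x: "x \<in> W"
  shows "f (spoke (side x)) = spoke (side (f x))"
proof -
  have "f (spoke (side x)) \<in> {spoke (f (side x)), side (f (side x))}"
    using automorphism_square[OF f, of "side x"] x by auto
  moreover have "f (spoke (side x)) \<noteq> f x" using f x by (simp add: automorphism_inj)
  ultimately show ?thesis
    using automorphism_square(2)[OF f x] automorphism_in_W[OF f x]
    by (auto simp: side_spoke)
qed

text \<open>By size, divisibility forces n = 2 (b - 3) = 4 (s - 1). As \<open>n\<close> divides 2 (s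
  - 1) (s + 1), s must be odd, which makes \<open>n\<close> a multiple of 8.\<close>

lemma exceptional_iff:
  "N dvd 2 * (int b - 3) \<longleftrightarrow> [n = 0] (mod 8) \<and> b = (n + 6) div 2"
proof
  assume "N dvd 2 * (int b - 3)"
  then obtain k where k: "2 * (int b - 3) = N * k" ..
  have "0 < 2 * (int b - 3)" "2 * (int b - 3) < N * 2" using b_bounds by auto
  then have "0 < N * k" "N * k < N * 2" unfolding k .
  then have "k = 1" using n_gt by (simp add: zero_less_mult_iff mult_less_cancel_left)
  then have n: "N = 2 * (int b - 3)" using k by simp
  obtain s where s: "int b = 2 * s + 1" "s > 1" "N dvd 2 * s\<^sup>2 - 2" by (rule half_b)
  have "4 * (s - 1) dvd 2 * (s - 1) * (s + 1)"
    using s(3) unfolding n s(1) by (simp add: algebra_simps power2_eq_square)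
  then have "2 * (s - 1) * 2 dvd 2 * (s - 1) * (s + 1)" by (simp add: algebra_simps)
  then have "2 dvd s + 1" using s(2) by (subst (asm) dvd_mult_cancel_left) simp
  then obtain t where "s = 2 * t + 1" by (metis dvd_add_right_iff odd_one even_plus_one_iff oddE)
  then have "N = 8 * t" using n s(1) by simp
  then have "8 dvd n" by presburger
  then show "[n = 0] (mod 8) \<and> b = (n + 6) div 2"
    using n by (simp add: cong_0_iff)
next
  assume "[n = 0] (mod 8) \<and> b = (n + 6) div 2"
  then have "8 dvd n" "b = (n + 6) div 2" by (simp_all add: cong_0_iff)
  then have "2 * (int b - 3) = N" by presburger
  then show "N dvd 2 * (int b - 3)" by simp
qed

subsection \<open>Automorphisms and spokes\<close>

text \<open>One of the two rounds of the walk; \<open>g\<close> is the choice of the edge in the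
  second square.\<close>

definition walk :: "(mo_vertex \<Rightarrow> mo_vertex) \<Rightarrow> mo_vertex \<Rightarrow> mo_vertex" where
  "walk g x = link (g (link (spoke (side x))))"

text \<open>Such a round shifts the subscript by an odd amount whose sign depends on the parity, so
  the second round undoes the first.\<close>

lemma walk_spoke_spoke:
  "x \<in> W \<Longrightarrow> walk spoke (walk spoke x) = x"
  using odd_b
  by (auto elim!: W_cases simp: walk_def side_uv link_uv u_eq_iff v_eq_iff)

text \<open>Each round keeps the parity and passes between the \<open>u i\<close> and the
  \<open>v i\<close>. For even subscripts the two shifts are 2 - 2 b and 4, for odd ones their
  negatives.\<close>

lemma walk_side_side:
  assumes "x \<in> W" "walk side (walk side x) = x"
  shows "N dvd 2 * (int b - 3)"
proof -
  have "N dvd 2 * (int b - 3) \<or> N dvd - (2 * (int b - 3))"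
    using assms odd_b
    by (auto elim!: W_cases simp: walk_def side_uv link_uv u_eq_iff v_eq_iff algebra_simps
        split: if_splits)
  then show ?thesis using dvd_minus_iff[of N "2 * (int b - 3)"] by blast
qed

text \<open>Three spokes are crossed in all, so the walk ends on the other side of them.\<close>

lemma walk_mixed:
  assumes "x \<in> W"
  shows "walk spoke (walk side x) \<noteq> x"
  using assms odd_b
  by (auto elim!: W_cases simp: walk_def side_uv link_uv split: if_splits)

lemma automorphism_spoke:
  assumes f: "automorphism X f" and x: "x \<in> W" and ne: "\<not> N dvd 2 * (int b - 3)"
  shows "f (spoke x) = spoke (f x)"
proof -
  \<comment> \<open>The starting point is chosen so that the first round from \<open>y\<close>
    arrives at \<open>x\<close> just before its choice between spoke and side.\<close>
  define y where "y = spoke (side (link x))"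
  have y: "y \<in> W" "link (spoke (side y)) = x"
    using x by (simp_all add: y_def side_spoke)
  have step: "f (walk spoke z) \<in> {walk spoke (f z), walk side (f z)}" if "z \<in> W" for z
    using automorphism_square(1)[OF f, of "link (spoke (side z))"] that f
    by (auto simp: walk_def automorphism_link automorphism_opposite)
  have y': "walk spoke y \<in> W" using x y by (simp add: walk_def)
  have fy: "f y \<in> W" using automorphism_in_W f y by blast
  \<comment> \<open>Otherwise the closed walk from \<open>y\<close> would be mapped to a closed walk
    from \<open>f y\<close> that uses a side in its first round.\<close>
  have "f (walk spoke y) \<noteq> walk side (f y)"
  proof
    assume *: "f (walk spoke y) = walk side (f y)"
    have "f (walk spoke (walk spoke y)) \<in> {walk spoke (walk side (f y)), walk side (walk side (f y))}"
      using step[OF y'] unfolding * .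
    then show False
      using walk_mixed[OF fy] walk_side_side[OF fy] ne unfolding walk_spoke_spoke[OF y(1)]
      by (metis insertE singletonD)
  qed
  then have "f (walk spoke y) = walk spoke (f y)"
    using step[OF y(1)] by blast
  moreover have "walk spoke y = link (spoke x)"
    using y(2) by (simp add: walk_def)
  moreover have "link (spoke (side (f y))) = f (link (spoke (side y)))"
    using f y(1) by (simp add: automorphism_link automorphism_opposite)
  then have "walk spoke (f y) = link (spoke (f x))"
    using y(2) by (simp add: walk_def)
  ultimately have "link (f (spoke x)) = link (spoke (f x))"
    using f x by (simp add: automorphism_link)
  then have "link (link (f (spoke x))) = link (link (spoke (f x)))" by simp
  then show ?thesis
    using automorphism_in_W[OF f] x by simp
qed

lemma automorphism_side:
  assumes f: "automorphism X f" and x: "x \<in> W" and ne: "\<not> N dvd 2 * (int b - 3)"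
  shows "f (side x) = side (f x)"
proof -
  have "f (side x) \<noteq> f (spoke x)" using f x by (simp add: automorphism_inj)
  then show ?thesis
    using automorphism_square(2)[OF f x] automorphism_spoke[OF f x ne] by auto
qed

subsection \<open>Vertex-transitivity\<close>

text \<open>Adjacency is reflected as well as preserved because the inverse map \<open>g\<close>
  also preserves edges.\<close>

lemma automorphismI:
  assumes W: "\<And>x. x \<in> W \<Longrightarrow> f x \<in> W" "\<And>x. x \<in> W \<Longrightarrow> g x \<in> W"
    and inv: "\<And>x. x \<in> W \<Longrightarrow> g (f x) = x" "\<And>x. x \<in> W \<Longrightarrow> f (g x) = x"
    and E: "\<And>x. x \<in> W \<Longrightarrow> {f x, f (spoke x)} \<in> E" "\<And>x. x \<in> W \<Longrightarrow> {f x, f (side x)} \<in> E"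
      "\<And>x. x \<in> W \<Longrightarrow> {f x, f (link x)} \<in> E"
    and E': "\<And>x. x \<in> W \<Longrightarrow> {g x, g (spoke x)} \<in> E" "\<And>x. x \<in> W \<Longrightarrow> {g x, g (side x)} \<in> E"
      "\<And>x. x \<in> W \<Longrightarrow> {g x, g (link x)} \<in> E"
  shows "automorphism X f"
proof -
  have "bij_betw f W W"
    using W inv by (intro bij_betw_byWitness[where f' = g]) auto
  moreover have "{f x, f y} \<in> E" if "{x, y} \<in> E" for x y
    using E[of x] that[unfolded edge_iff] by blast
  moreover have "{g x, g y} \<in> E" if "{x, y} \<in> E" for x y
    using E'[of x] that[unfolded edge_iff] by blast
  then have "{x, y} \<in> E" if "x \<in> W" "y \<in> W" "{f x, f y} \<in> E" for x y
    using that(3) inv(1)[OF that(1)] inv(1)[OF that(2)] by metis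
  ultimately show ?thesis
    unfolding automorphism_def by blast
qed

section \<open>Rotation, reflection and the exchange of the two rims\<close>

definition rotation :: "int \<Rightarrow> mo_vertex \<Rightarrow> mo_vertex" where
  "rotation c x = (case x of U k \<Rightarrow> u (int k + c) | V k \<Rightarrow> v (int k + c))"

text \<open>The constant 1 is odd, so parities are exchanged; this compensates for the reversal of
  the edges that run upwards from even subscripts.\<close>

definition reflection :: "mo_vertex \<Rightarrow> mo_vertex" where
  "reflection x = (case x of U k \<Rightarrow> u (1 - int k) | V k \<Rightarrow> v (1 - int k))"

text \<open>The vertex with subscript \<open>exchange_index i\<close> is the \<open>i\<close>-th one along the cycle
  \<open>v\<^sub>0, v\<^sub>1, v\<^sub>1\<^sub>-\<^sub>b, v\<^sub>2\<^sub>-\<^sub>b, \<dots>\<close> formed by the \<open>v\<^sub>i\<close>. The congruence on \<open>b\<close> makes it an involution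
  modulo \<open>n\<close>.\<close>

definition exchange_index :: "int \<Rightarrow> int" where
  "exchange_index i = (i div 2) * (1 - int b) + i mod 2"

definition exchange :: "mo_vertex \<Rightarrow> mo_vertex" where
  "exchange x =
    (case x of U k \<Rightarrow> v (exchange_index (int k)) | V k \<Rightarrow> u (exchange_index (int k)))"

lemma rotation_uv [simp]: "rotation c (u i) = u (i + c)" "rotation c (v i) = v (i + c)"
  using n_gt by (simp_all add: rotation_def u_def v_def mod_simps)

lemma reflection_uv [simp]: "reflection (u i) = u (1 - i)" "reflection (v i) = v (1 - i)"
  using n_gt by (simp_all add: reflection_def u_def v_def mod_simps)

text \<open>Adding n k changes \<open>i div 2\<close> by n k / 2 only, but the factor 1 - b is
  even.\<close>

lemma exchange_index_cong:
  assumes "N dvd i - j" shows "N dvd exchange_index i - exchange_index j"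
proof -
  obtain k where k: "i - j = N * k" using assms ..
  obtain m where m: "N = 2 * m" using even_n by (metis even_of_nat evenE)
  obtain s where s: "int b = 2 * s + 1" by (rule half_b)
  have "i = j + m * k * 2" using k m by simp
  then have "i div 2 = m * k + j div 2" "i mod 2 = j mod 2" by simp_all
  then have "exchange_index i - exchange_index j = N * (- s * k)"
    by (simp add: exchange_index_def m s algebra_simps)
  then show ?thesis ..
qed

lemma exchange_uv [simp]:
  "exchange (u i) = v (exchange_index i)" "exchange (v i) = u (exchange_index i)"
proof -
  have "N dvd exchange_index (int (nat (i mod N))) - exchange_index i"
    using n_gt by (intro exchange_index_cong) (simp add: mod_eq_dvd_iff[symmetric])
  then show "exchange (u i) = v (exchange_index i)" "exchange (v i) = u (exchange_index i)"
    unfolding exchange_def u_def[of i] v_def[of i] by (simp_all add: u_eq_iff v_eq_iff)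
qed

lemma even_exchange_index [simp]: "even (exchange_index i) \<longleftrightarrow> even i"
  using odd_b by (simp add: exchange_index_def)

lemma exchange_index_double:
  "exchange_index (2 * k) = k * (1 - int b)" "exchange_index (2 * k + 1) = k * (1 - int b) + 1"
  by (simp_all add: exchange_index_def)

text \<open>Steps along the cycle of the \<open>u i\<close> become steps along that of the
  \<open>v i\<close>, exactly and not just modulo \<open>n\<close>.\<close>

lemma exchange_index_shift:
  "even i \<Longrightarrow> exchange_index (i + 1) = exchange_index i + 1"
  "odd i \<Longrightarrow> exchange_index (i - 1) = exchange_index i - 1"
  "even i \<Longrightarrow> exchange_index (i - 1) = exchange_index i + int b"
  "odd i \<Longrightarrow> exchange_index (i + 1) = exchange_index i - int b"
proof -
  show "exchange_index (i + 1) = exchange_index i + 1"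
    "exchange_index (i - 1) = exchange_index i + int b" if "even i"
  proof -
    obtain k where "i = 2 * k" using \<open>even i\<close> ..
    then show "exchange_index (i + 1) = exchange_index i + 1"
      "exchange_index (i - 1) = exchange_index i + int b"
      using exchange_index_double[of k] exchange_index_double(2)[of "k - 1"]
      by (simp_all add: algebra_simps)
  qed
  show "exchange_index (i - 1) = exchange_index i - 1"
    "exchange_index (i + 1) = exchange_index i - int b" if "odd i"
  proof -
    obtain k where "i = 2 * k + 1" using \<open>odd i\<close> ..
    then show "exchange_index (i - 1) = exchange_index i - 1"
      "exchange_index (i + 1) = exchange_index i - int b"
      using exchange_index_double[of k] exchange_index_double(1)[of "k + 1"]
      by (simp_all add: algebra_simps)
  qed
qed

text \<open>Even subscripts are multiplied by -s each time, and 2 s^2 = 2 modulo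
  \<open>n\<close>.\<close>

lemma exchange_index_exchange_index:
  "N dvd exchange_index (exchange_index i) - i"
proof -
  obtain s where s: "int b = 2 * s + 1" "N dvd 2 * s\<^sup>2 - 2" by (rule half_b)
  obtain k where k: "i = 2 * k \<or> i = 2 * k + 1" by (metis evenE oddE)
  have *: "k * (1 - int b) = 2 * (- k * s)" by (simp add: s)
  have "exchange_index (exchange_index i) - i = (2 * s\<^sup>2 - 2) * k"
    using k by (elim disjE; simp only: exchange_index_double *)
      (simp_all add: s algebra_simps power2_eq_square)
  then show ?thesis using s(2) by simp
qed

lemma exchange_index_b:
  assumes "even i"
  shows "N dvd exchange_index (i + int b) - (exchange_index i - 1)"
proof -
  obtain s where s: "int b = 2 * s + 1" "N dvd 2 * s\<^sup>2 - 2" by (rule half_b)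
  obtain k where k: "i = 2 * k" using assms ..
  then have "i + int b = 2 * (k + s) + 1" using s by simp
  then have "exchange_index (i + int b) - (exchange_index i - 1) = - (2 * s\<^sup>2 - 2)"
    by (simp only: exchange_index_double k) (simp add: s power2_eq_square algebra_simps)
  then show ?thesis using s(2) by (simp only: dvd_minus_iff)
qed

lemma exchange_index_b':
  assumes "odd i"
  shows "N dvd exchange_index (i - int b) - (exchange_index i + 1)"
proof -
  have "N dvd exchange_index i - (exchange_index (i - int b) - 1)"
    using exchange_index_b[of "i - int b"] assms odd_b by simp
  then have "N dvd - (exchange_index i - (exchange_index (i - int b) - 1))"
    by (simp only: dvd_minus_iff)
  then show ?thesis by (simp add: algebra_simps)
qed

lemma rotation_in_W: "x \<in> W \<Longrightarrow> rotation c x \<in> W"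
  by (auto elim: W_cases)

lemma rotation_rotation: "x \<in> W \<Longrightarrow> rotation c (rotation d x) = rotation (d + c) x"
  by (auto elim: W_cases simp: add.assoc)

lemma rotation_0: "x \<in> W \<Longrightarrow> rotation 0 x = x"
  by (auto elim: W_cases)

lemma rotation_mates:
  assumes "even c" "x \<in> W"
  shows "rotation c (spoke x) = spoke (rotation c x)" "rotation c (side x) = side (rotation c x)"
    "rotation c (link x) = link (rotation c x)"
  using assms(2,1) by (cases rule: W_cases; simp add: side_uv link_uv algebra_simps)+

lemma automorphism_rotation:
  assumes "even c" shows "automorphism X (rotation c)"
  by (rule automorphismI[where g = "rotation (- c)"])
    (use assms in \<open>simp_all add: rotation_mates rotation_in_W rotation_rotation rotation_0\<close>)

lemma reflection_mates:
  assumes "x \<in> W"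
  shows "reflection x \<in> W" "reflection (reflection x) = x"
    "reflection (spoke x) = spoke (reflection x)" "reflection (side x) = side (reflection x)"
    "reflection (link x) = link (reflection x)"
  using assms by (cases rule: W_cases; simp add: side_uv link_uv algebra_simps)+

lemma automorphism_reflection: "automorphism X reflection"
  by (rule automorphismI[where g = reflection])
    (simp_all add: reflection_mates)

lemma exchange_mates:
  assumes "x \<in> W"
  shows "exchange x \<in> W" "exchange (exchange x) = x" "exchange (spoke x) = spoke (exchange x)"
    "exchange (side x) = side (exchange x)" "exchange (link x) = link (exchange x)"
proof -
  note 1 = side_uv link_uv u_eq_iff v_eq_iff exchange_index_shift exchange_index_exchange_index
  have "exchange x \<in> W \<and> exchange (exchange x) = x \<and> exchange (spoke x) = spoke (exchange x) \<and>
    exchange (side x) = side (exchange x) \<and> exchange (link x) = link (exchange x)"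
    using assms
  proof (cases rule: W_cases)
    case (u i)
    show ?thesis by (cases "even i") (simp_all add: u 1)
  next
    case (v i)
    show ?thesis
      using exchange_index_b[of i] exchange_index_b'[of i]
      by (cases "even i") (simp_all add: v 1)
  qed
  then show "exchange x \<in> W" "exchange (exchange x) = x" "exchange (spoke x) = spoke (exchange x)"
    "exchange (side x) = side (exchange x)" "exchange (link x) = link (exchange x)"
    by simp_all
qed

lemma automorphism_exchange: "automorphism X exchange"
  by (rule automorphismI[where g = exchange]) (simp_all add: exchange_mates)

text \<open>An odd subscript is first made even by the reflection, then rotated to 0;
  \<open>exchange\<close> reduces the \<open>v i\<close> to the \<open>u i\<close>.\<close>

lemma to_base:
  assumes "x \<in> W" obtains f where "automorphism X f" "f x = u 0"
proof -
  have u: "\<exists>f. automorphism X f \<and> f (u i) = u 0" for i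
  proof (cases "even i")
    case True
    then show ?thesis
      using automorphism_rotation[of "- i"] by (intro exI[of _ "rotation (- i)"]) simp
  next
    case False
    then have "automorphism X (rotation (i - 1) \<circ> reflection)"
      by (intro automorphism_comp automorphism_rotation automorphism_reflection) simp
    then show ?thesis by (intro exI[of _ "rotation (i - 1) \<circ> reflection"]) simp
  qed
  have v: "\<exists>f. automorphism X f \<and> f (v i) = u 0" for i
  proof -
    obtain f where "automorphism X f" "f (u (exchange_index i)) = u 0" using u by blast
    then show ?thesis
      using automorphism_comp[OF automorphism_exchange]
      by (intro exI[of _ "f \<circ> exchange"]) simp
  qed
  from assms show ?thesis
    by (cases rule: W_cases) (use u v that in blast)+
qed

lemma from_base:
  assumes "x \<in> W" obtains f where "automorphism X f" "f (u 0) = x"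
proof -
  have u: "\<exists>f. automorphism X f \<and> f (u 0) = u i" for i
  proof (cases "even i")
    case True
    then show ?thesis
      using automorphism_rotation[of i] by (intro exI[of _ "rotation i"]) simp
  next
    case False
    then have "automorphism X (rotation (i - 1) \<circ> reflection)"
      by (intro automorphism_comp automorphism_rotation automorphism_reflection) simp
    then show ?thesis by (intro exI[of _ "rotation (i - 1) \<circ> reflection"]) simp
  qed
  have v: "\<exists>f. automorphism X f \<and> f (u 0) = v i" for i
  proof -
    obtain f where f: "automorphism X f" "f (u 0) = u (exchange_index i)" using u by blast
    have "exchange (u (exchange_index i)) = v i"
      using exchange_index_exchange_index by (simp add: v_eq_iff)
    then show ?thesis
      using f automorphism_comp[OF f(1) automorphism_exchange]
      by (intro exI[of _ "exchange \<circ> f"]) simp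
  qed
  from assms show ?thesis
    by (cases rule: W_cases) (use u v that in blast)+
qed

lemma vertex_transitive_X: "vertex_transitive X"
  unfolding vertex_transitive_def
proof (intro ballI)
  fix x y assume "x \<in> W" "y \<in> W"
  obtain f where f: "automorphism X f" "f x = u 0"
    using \<open>x \<in> W\<close> by (rule to_base)
  obtain g where g: "automorphism X g" "g (u 0) = y"
    using \<open>y \<in> W\<close> by (rule from_base)
  show "\<exists>f. automorphism X f \<and> f x = y"
    using automorphism_comp[OF f(1) g(1)] f g by (intro exI[of _ "g \<circ> f"]) simp
qed

subsection \<open>Invariant partitions\<close>

definition mate_edges :: "(mo_vertex \<Rightarrow> mo_vertex) \<Rightarrow> mo_vertex set set" where
  "mate_edges h = (\<lambda>x. {x, h x}) ` W"

text \<open>These are the edges among the \<open>u i\<close> and those among the \<open>v i\<close>,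
  the 2-factor complementary to the spokes.\<close>

abbreviation rims :: "mo_vertex set set" where
  "rims \<equiv> mate_edges side \<union> mate_edges link"

lemma mate_edges_incident:
  assumes "x \<in> W" "\<And>y. y \<in> W \<Longrightarrow> h (h y) = y"
  shows "{e \<in> mate_edges h. x \<in> e} = {{x, h x}}"
  using assms by (auto simp: mate_edges_def)

lemma mate_edges_iff:
  assumes "\<And>y. y \<in> W \<Longrightarrow> h (h y) = y" "\<And>y. y \<in> W \<Longrightarrow> h y \<in> W"
  shows "{x, y} \<in> mate_edges h \<longleftrightarrow> x \<in> W \<and> y = h x"
  using assms by (auto simp: mate_edges_def doubleton_eq_iff)

lemma E_eq_mate_edges: "E = mate_edges spoke \<union> rims"
proof (intro equalityI subsetI)
  fix e assume "e \<in> E"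
  then obtain x y where "e = {x, y}" unfolding E_eq by auto
  with \<open>e \<in> E\<close> show "e \<in> mate_edges spoke \<union> rims"
    by (auto simp: edge_iff mate_edges_def)
qed (auto simp: mate_edges_def)

lemma spokes_rims_disjoint: "mate_edges spoke \<inter> rims = {}"
  by (auto simp: mate_edges_def doubleton_eq_iff)

lemma k_factor_spokes: "k_factor 1 X (mate_edges spoke)"
  unfolding k_factor_def E_eq_mate_edges
  by (auto simp: mate_edges_incident)

lemma k_factor_rims: "k_factor 2 X rims"
  unfolding k_factor_def
proof (intro conjI ballI)
  fix x assume "x \<in> W"
  have "{e \<in> rims. x \<in> e} = {e \<in> mate_edges side. x \<in> e} \<union> {e \<in> mate_edges link. x \<in> e}"
    by auto
  also have "\<dots> = {{x, side x}, {x, link x}}"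
    using \<open>x \<in> W\<close> by (simp add: mate_edges_incident insert_commute)
  finally show "card {e \<in> rims. x \<in> e} = 2"
    using \<open>x \<in> W\<close> by (simp add: doubleton_eq_iff)
qed (use E_eq_mate_edges in blast)

lemma image_mate_edges:
  assumes f: "automorphism X f" and comm: "\<And>x. x \<in> W \<Longrightarrow> f (h x) = h (f x)"
  shows "(`) f ` mate_edges h = mate_edges h"
proof -
  have "f ` W = W" using f by (simp add: automorphism_def bij_betw_def)
  have "(`) f ` mate_edges h = (\<lambda>x. {f x, h (f x)}) ` W"
    using comm by (auto simp: mate_edges_def image_image)
  also have "\<dots> = (\<lambda>x. {x, h x}) ` f ` W"
    by (simp add: image_image)
  finally show ?thesis by (simp add: \<open>f ` W = W\<close> mate_edges_def)
qed

lemma component_rims_u: "component rims (u i) = range u"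
proof
  let ?R = "{(p, q). {p, q} \<in> rims}"
  have "q \<in> range u" if "(u i, q) \<in> ?R\<^sup>*" for q
    using that by (induction rule: rtrancl_induct) (auto simp: mate_edges_iff side_uv link_uv)
  then show "component rims (u i) \<subseteq> range u" by (auto simp: component_def)
  have step: "(u j, u (j + 1)) \<in> ?R" for j
    by (auto simp: mate_edges_iff side_uv link_uv)
  have path: "(u i, u (i + int k)) \<in> ?R\<^sup>*" for k
  proof (induction k)
    case (Suc k)
    then have "(u i, u (i + int k + 1)) \<in> ?R\<^sup>*"
      using step[of "i + int k"] by (rule rtrancl_into_rtrancl)
    moreover have "i + int (Suc k) = i + int k + 1" by simp
    ultimately show ?case by (simp only:)
  qed simp
  show "range u \<subseteq> component rims (u i)"
  proof
    fix q assume "q \<in> range u"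
    then obtain j where j: "q = u j" by auto
    \<comment> \<open>Reducing the difference modulo \<open>n\<close> makes it nonnegative, so
      walking upwards is enough.\<close>
    have "u j = u (i + int (nat ((j - i) mod N)))"
      using n_gt by (simp add: u_eq_iff mod_eq_dvd_iff[symmetric] mod_simps)
    then have "(u i, u j) \<in> ?R\<^sup>*"
      using path by (simp only:)
    then show "q \<in> component rims (u i)"
      by (simp add: component_def j)
  qed
qed

text \<open>\<open>exchange\<close> commutes with \<open>side\<close> and \<open>link\<close>, so it
  carries paths along the \<open>u i\<close> to paths along the \<open>v i\<close>.\<close>

lemma component_rims_v: "component rims (v i) = range v"
proof
  let ?R = "{(p, q). {p, q} \<in> rims}"
  have "q \<in> range v" if "(v i, q) \<in> ?R\<^sup>*" for q
    using that by (induction rule: rtrancl_induct) (auto simp: mate_edges_iff side_uv link_uv)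
  then show "component rims (v i) \<subseteq> range v" by (auto simp: component_def)
  have lift: "(exchange p, exchange q) \<in> ?R\<^sup>*" if "(p, q) \<in> ?R\<^sup>*" for p q
    using that
  proof (induction rule: rtrancl_induct)
    case (step q r)
    then have "(exchange q, exchange r) \<in> ?R"
      by (auto simp: mate_edges_iff exchange_mates)
    then show ?case using step.IH by (rule rtrancl_into_rtrancl[rotated])
  qed simp
  show "range v \<subseteq> component rims (v i)"
  proof
    fix q assume "q \<in> range v"
    then obtain j where j: "q = v j" by auto
    have "(u (exchange_index i), u (exchange_index j)) \<in> ?R\<^sup>*"
      using component_rims_u[of "exchange_index i"] by (auto simp: component_def)
    from lift[OF this] have "(v i, v j) \<in> ?R\<^sup>*"
      using exchange_mates(2)[of "v i"] exchange_mates(2)[of "v j"] by simp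
    then show "q \<in> component rims (v i)" by (simp add: component_def j)
  qed
qed

lemma F12_invariant_X:
  assumes ne: "\<not> N dvd 2 * (int b - 3)"
  shows "F12_invariant X"
proof -
  have "component rims ` W = {range u, range v}"
    by (auto simp: W_eq image_Un image_image component_rims_u component_rims_v)
  moreover have "range u \<noteq> range v" using u_neq_v by blast
  ultimately have "composed_of_two_cycles X rims"
    by (simp add: composed_of_two_cycles_def k_factor_rims)
  moreover have "invariant_12_partition X (mate_edges spoke) rims"
    unfolding invariant_12_partition_def
    using k_factor_spokes k_factor_rims E_eq_mate_edges spokes_rims_disjoint ne
    by (simp add: image_Un image_mate_edges automorphism_spoke automorphism_side automorphism_link)
  ultimately show ?thesis
    using vertex_transitive_X unfolding F12_invariant_def by blast
qed

section \<open>The obstruction posed by an automorphism interchanging spoke and side\<close>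

lemma invariant_edge:
  assumes "invariant_12_partition X F1 F2" "automorphism X f" "{x, y} \<in> F1"
  shows "{f x, f y} \<in> F1"
proof -
  have "f ` {x, y} \<in> (`) f ` F1" using assms(3) by (rule imageI)
  then show ?thesis using assms(1,2) by (simp add: invariant_12_partition_def)
qed

lemma link_in_F1_if_swap:
  assumes g: "automorphism X g" "x \<in> W" "g x = x" "g (spoke x) = side x" "g (side x) = spoke x"
    and F: "invariant_12_partition X F1 F2" and "w \<in> W"
  shows "{w, link w} \<in> F1"
proof -
  have F1: "k_factor 1 X F1"
    using F by (auto simp: invariant_12_partition_def)
  have "card {e \<in> F1. x \<in> e} = 1"
    using F1(1) \<open>x \<in> W\<close> unfolding k_factor_def by blast
  then obtain e where e: "{e \<in> F1. x \<in> e} = {e}" by (rule card_1_singletonE)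
  then have "e \<in> F1" "x \<in> e" by auto
  then have "e \<in> E" using F1(1) unfolding k_factor_def by auto
  then obtain p q where "e = {p, q}" unfolding E_eq by auto
  then have "e = {x, q} \<or> e = {x, p}" using \<open>x \<in> e\<close> by auto
  then obtain y where y: "e = {x, y}" by metis
  have y': "y = spoke x \<or> y = side x \<or> y = link x"
    using \<open>e \<in> E\<close> unfolding y edge_iff by simp
  have "y = link x"
  proof (rule ccontr)
    assume "y \<noteq> link x"
    \<comment> \<open>Invariance under \<open>g\<close> would put both edges into the 1-factor,
      which has just one edge at \<open>x\<close>.\<close>
    then have "{x, spoke x} \<in> F1 \<or> {x, side x} \<in> F1"
      using y' \<open>e \<in> F1\<close> unfolding y by metis
    then have "{x, spoke x} \<in> F1 \<and> {x, side x} \<in> F1"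
      using invariant_edge[OF F g(1), of x "spoke x"] invariant_edge[OF F g(1), of x "side x"]
      unfolding g(3-5) by argo
    then have "{x, spoke x} \<in> {e}" "{x, side x} \<in> {e}" unfolding e[symmetric] by simp_all
    then have "{x, spoke x} = {x, side x}" unfolding singleton_iff by (rule trans[OF _ sym])
    then show False using \<open>x \<in> W\<close> by (simp add: doubleton_eq_iff)
  qed
  obtain h where h: "automorphism X h" "h x = w"
    using vertex_transitive_X \<open>x \<in> W\<close> \<open>w \<in> W\<close> unfolding vertex_transitive_def by blast
  have "{x, link x} \<in> F1" using \<open>e \<in> F1\<close> unfolding y \<open>y = link x\<close> .
  then have "{h x, h (link x)} \<in> F1" by (rule invariant_edge[OF F h(1)])
  then show ?thesis
    unfolding automorphism_link[OF h(1) \<open>x \<in> W\<close>] h(2) .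
qed

text \<open>Once the links are removed, a path cannot leave the square of its starting
  point.\<close>

lemma component_le_4:
  assumes link_F1: "\<And>w. w \<in> W \<Longrightarrow> {w, link w} \<in> F1"
    and F: "F1 \<inter> F2 = {}" "F2 \<subseteq> E" and "w \<in> W"
  shows "card (component F2 w) \<le> 4" "finite (component F2 w)"
proof -
  have "q \<in> {w, spoke w, side w, spoke (side w)}" if "(w, q) \<in> {(p, q). {p, q} \<in> F2}\<^sup>*" for q
    using that
  proof (induction rule: rtrancl_induct)
    case (step p q)
    then have "{p, q} \<in> E" "{p, q} \<notin> F1" using F by auto
    then have "q = spoke p \<or> q = side p" using link_F1[of p] unfolding edge_iff by blast
    moreover have "p \<in> {w, spoke w, side w, spoke (side w)}" using step.IH .
    ultimately show ?case using \<open>w \<in> W\<close> by (auto simp: side_spoke)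
  qed simp
  then have comp: "component F2 w \<subseteq> set [w, spoke w, side w, spoke (side w)]"
    unfolding component_def by auto
  show "finite (component F2 w)"
    using finite_subset[OF comp] by simp
  have "card (component F2 w) \<le> card (set [w, spoke w, side w, spoke (side w)])"
    using comp by (rule card_mono[rotated]) simp
  also have "\<dots> \<le> 4"
    by (rule order_trans[OF card_length]) simp
  finally show "card (component F2 w) \<le> 4" .
qed

lemma card_W: "card W = 2 * n"
proof -
  have "card W = card (U ` {..<n}) + card (V ` {..<n})"
    unfolding X_def MO_def fst_conv by (rule card_Un_disjoint) auto
  then show ?thesis by (simp add: card_image inj_on_def)
qed

text \<open>Two components of at most 4 vertices cannot cover the 2 n > 8 vertices.\<close>

lemma not_two_cycles_if_swap:
  assumes g: "automorphism X g" "x \<in> W" "g x = x" "g (spoke x) = side x" "g (side x) = spoke x"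
    and F: "invariant_12_partition X F1 F2"
  shows "\<not> composed_of_two_cycles X F2"
proof
  have "F1 \<inter> F2 = {}" "F2 \<subseteq> E"
    using F by (auto simp: invariant_12_partition_def)
  note small = component_le_4[OF link_in_F1_if_swap[OF g F] this]
  assume "composed_of_two_cycles X F2"
  then have "card (component F2 ` W) = 2"
    by (simp add: composed_of_two_cycles_def)
  then obtain A B where AB: "component F2 ` W = {A, B}"
    by (auto simp: card_2_iff)
  have "w \<in> component F2 w" for w by (simp add: component_def)
  then have "W \<subseteq> \<Union> (component F2 ` W)" by blast
  then have "W \<subseteq> A \<union> B" unfolding AB by simp
  moreover have "A \<in> component F2 ` W" "B \<in> component F2 ` W" unfolding AB by simp_all
  then have "finite A" "finite B" "card A \<le> 4" "card B \<le> 4" using small by blast+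
  ultimately have "card W \<le> 8"
    using card_mono[of "A \<union> B" W] card_Un_le[of A B] by simp
  then show False using n_gt card_W by simp
qed

end

subsection \<open>The exceptional case\<close>

text \<open>\<open>M\<close> is half of \<open>n\<close>; since it is even, residues modulo
  \<open>M\<close> determine the parity of a subscript.\<close>

locale exceptional_mo_graph = mo_graph +
  fixes M :: int
  assumes N_eq: "N = 2 * M" and b_eq: "int b = M + 3" and even_M: "even M"
begin

lemma M_ge: "M \<ge> 6"
proof -
  have "M > 5" using b_less N_eq b_eq by linarith
  then show ?thesis by simp
qed

text \<open>Number the squares by \<open>i div 2\<close> modulo \<open>M\<close>. For \<open>b = M + 3\<close> the squares \<open>j\<close> and \<open>j + M / 2\<close>
  have the same neighbours, namely the squares \<open>j \<plusminus> 1\<close> and \<open>j + M / 2 \<plusminus> 1\<close>. The map \<open>swap\<close>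
  interchanges the squares 0 and \<open>M / 2\<close>; to keep up with this, each of the four adjacent squares
  is reflected in the diagonal not met by the links to 0 and \<open>M / 2\<close>.\<close>

definition swap :: "mo_vertex \<Rightarrow> mo_vertex" where
  "swap x = (case x of
     U k \<Rightarrow> (let i = int k; r = i mod M in
       if r = 0 then v (i + 1 + M) else if r = 1 then v (i - 1 + M)
       else if r = 2 then v (i + 1) else if r = M - 1 then v (i - 1) else u i)
   | V k \<Rightarrow> (let i = int k; r = i mod M in
       if r = 0 then u (i + 1 + M) else if r = 1 then u (i - 1 + M)
       else if r = 3 then u (i - 1) else if r = M - 2 then u (i + 1) else v i))"

text \<open>As \<open>M\<close> divides \<open>n\<close>, the case distinction does not depend on
  the representative of the subscript.\<close>

lemma swap_uv:
  "swap (u i) =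
    (if i mod M = 0 then v (i + 1 + M) else if i mod M = 1 then v (i - 1 + M)
     else if i mod M = 2 then v (i + 1) else if i mod M = M - 1 then v (i - 1) else u i)"
  "swap (v i) =
    (if i mod M = 0 then u (i + 1 + M) else if i mod M = 1 then u (i - 1 + M)
     else if i mod M = 3 then u (i - 1) else if i mod M = M - 2 then u (i + 1) else v i)"
proof -
  have *: "(i mod N) mod M = i mod M"
    using N_eq by (intro mod_mod_cancel) simp
  have **: "u (i mod N) = u i" "v (i mod N) = v i"
    "u (i mod N + c) = u (i + c)" "v (i mod N + c) = v (i + c)"
    "u (i mod N - c) = u (i - c)" "v (i mod N - c) = v (i - c)"
    "u (i mod N + c + M) = u (i + c + M)" "v (i mod N + c + M) = v (i + c + M)"
    "u (i mod N - c + M) = u (i - c + M)" "v (i mod N - c + M) = v (i - c + M)" for c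
    by (simp_all add: u_eq_iff v_eq_iff mod_eq_dvd_iff[symmetric])
  have "int (nat (i mod N)) = i mod N" using n_gt by simp
  then show "swap (u i) =
    (if i mod M = 0 then v (i + 1 + M) else if i mod M = 1 then v (i - 1 + M)
     else if i mod M = 2 then v (i + 1) else if i mod M = M - 1 then v (i - 1) else u i)"
  "swap (v i) =
    (if i mod M = 0 then u (i + 1 + M) else if i mod M = 1 then u (i - 1 + M)
     else if i mod M = 3 then u (i - 1) else if i mod M = M - 2 then u (i + 1) else v i)"
    unfolding swap_def u_def[of i] v_def[of i] mo_vertex.case Let_def
    by (simp_all only: * ** u_def[of i, symmetric] v_def[of i, symmetric])
qed

section \<open>Residues modulo \<open>M\<close> and the effect of \<open>swap\<close> on
  edges\<close>

lemma residue_add: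
  assumes "0 \<le> c" "c \<le> M"
  shows "(i + c) mod M = (if i mod M + c < M then i mod M + c else i mod M + c - M)"
proof -
  have r: "0 \<le> i mod M" "i mod M < M" using M_ge by simp_all
  have "(i + c) mod M = (i mod M + c) mod M" by (simp add: mod_simps)
  also have "\<dots> = (if i mod M + c < M then i mod M + c else i mod M + c - M)"
  proof (cases "i mod M + c < M")
    case True then show ?thesis using r assms by simp
  next
    case False
    have "(i mod M + c) mod M = (i mod M + c - M) mod M" by (simp add: mod_simps)
    also have "\<dots> = i mod M + c - M"
      by (rule mod_pos_pos_trivial) (use False r assms in linarith)+
    finally show ?thesis using False by simp
  qed
  finally show ?thesis .
qed

lemma residue_diff:
  assumes "0 \<le> c" "c \<le> M"
  shows "(i - c) mod M = (if i mod M < c then i mod M - c + M else i mod M - c)"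
proof -
  have "(i - c) mod M = (i + (M - c)) mod M"
    by (metis add_diff_eq diff_add_eq mod_add_self2)
  then show ?thesis using residue_add[of "M - c" i] assms by simp
qed

lemma residue_shift: "(i + M) mod M = i mod M"
  by simp

lemma residue_bounds: "0 \<le> i mod M" "i mod M < M"
  using M_ge by simp_all

lemma even_residue: "even (i mod M) \<longleftrightarrow> even i"
  using even_M by (simp add: dvd_mod_iff)

lemma swap_in_W: "x \<in> W \<Longrightarrow> swap x \<in> W"
  by (auto elim!: W_cases simp: swap_uv)

lemma swap_swap:
  assumes "x \<in> W" shows "swap (swap x) = x"
  using assms
proof (cases rule: W_cases)
  case (u i)
  show ?thesis
    using M_ge residue_bounds[of i] unfolding u
    by (auto simp: swap_uv residue_add residue_diff u_eq_iff N_eq)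
next
  case (v i)
  show ?thesis
    using M_ge residue_bounds[of i] unfolding v
    by (auto simp: swap_uv residue_add residue_diff v_eq_iff N_eq)
qed

text \<open>\<open>swap\<close> moves \<open>u i\<close> only for the residues 0, 1, 2 and M - 1;
  away from the first five cases both ends are fixed.\<close>

lemma swap_edge_uu: "{swap (u i), swap (u (i + 1))} \<in> E"
proof -
  consider "i mod M = 0" | "i mod M = 1" | "i mod M = 2" | "i mod M = M - 2" | "i mod M = M - 1"
    | "2 < i mod M" "i mod M < M - 2"
    using residue_bounds[of i] by linarith
  then show ?thesis
  proof cases
    case 1
    then have "(i + 1) mod M = 1" using M_ge by (simp add: residue_add)
    moreover have "even i" using 1 even_residue[of i] even_M by simp
    ultimately show ?thesis
      using 1 M_ge even_M
      by (auto simp: swap_uv edge_iff side_uv link_uv u_eq_iff v_eq_iff N_eq b_eq algebra_simps)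
  next
    case 2
    then have "(i + 1) mod M = 2" using M_ge by (simp add: residue_add)
    moreover have "odd i" using 2 even_residue[of i] even_M by simp
    ultimately show ?thesis
      using 2 M_ge even_M
      by (auto simp: swap_uv edge_iff side_uv link_uv u_eq_iff v_eq_iff N_eq b_eq algebra_simps)
  next
    case 3
    then have "(i + 1) mod M = 3" using M_ge by (simp add: residue_add)
    moreover have "even i" using 3 even_residue[of i] even_M by simp
    ultimately show ?thesis
      using 3 M_ge even_M
      by (auto simp: swap_uv edge_iff side_uv link_uv u_eq_iff v_eq_iff N_eq b_eq algebra_simps)
  next
    case 4
    then have "(i + 1) mod M = M - 1" using M_ge by (simp add: residue_add)
    moreover have "even i" using 4 even_residue[of i] even_M by simp
    ultimately show ?thesis
      using 4 M_ge even_M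
      by (auto simp: swap_uv edge_iff side_uv link_uv u_eq_iff v_eq_iff N_eq b_eq algebra_simps)
  next
    case 5
    then have "(i + 1) mod M = 0" using M_ge by (simp add: residue_add)
    moreover have "odd i" using 5 even_residue[of i] even_M by simp
    ultimately show ?thesis
      using 5 M_ge even_M
      by (auto simp: swap_uv edge_iff side_uv link_uv u_eq_iff v_eq_iff N_eq b_eq algebra_simps)
  next
    case 6
    then have "(i + 1) mod M = i mod M + 1" using M_ge by (simp add: residue_add)
    then show ?thesis
      using 6 by (auto simp: swap_uv E_eq)
  qed
qed

lemma swap_edge_uv: "{swap (u i), swap (v i)} \<in> E"
proof -
  consider "i mod M = 0" | "i mod M = 1" | "i mod M = 2" | "i mod M = 3" | "i mod M = M - 2"
    | "i mod M = M - 1" | "3 < i mod M" "i mod M < M - 2"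
    using residue_bounds[of i] by linarith
  then show ?thesis
  proof cases
    case 1
    then have "even i" using 1 even_residue[of i] even_M by simp
    then show ?thesis
      using 1 M_ge even_M
      by (auto simp: swap_uv edge_iff side_uv link_uv u_eq_iff v_eq_iff N_eq b_eq algebra_simps)
  next
    case 2
    then have "odd i" using 2 even_residue[of i] even_M by simp
    then show ?thesis
      using 2 M_ge even_M
      by (auto simp: swap_uv edge_iff side_uv link_uv u_eq_iff v_eq_iff N_eq b_eq algebra_simps)
  next
    case 3
    then have "even i" using 3 even_residue[of i] even_M by simp
    then show ?thesis
      using 3 M_ge even_M
      by (auto simp: swap_uv edge_iff side_uv link_uv u_eq_iff v_eq_iff N_eq b_eq algebra_simps)
  next
    case 4
    then have "odd i" using 4 even_residue[of i] even_M by simp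
    then show ?thesis
      using 4 M_ge even_M
      by (auto simp: swap_uv edge_iff side_uv link_uv u_eq_iff v_eq_iff N_eq b_eq algebra_simps)
  next
    case 5
    then have "even i" using 5 even_residue[of i] even_M by simp
    then show ?thesis
      using 5 M_ge even_M
      by (auto simp: swap_uv edge_iff side_uv link_uv u_eq_iff v_eq_iff N_eq b_eq algebra_simps)
  next
    case 6
    then have "odd i" using 6 even_residue[of i] even_M by simp
    then show ?thesis
      using 6 M_ge even_M
      by (auto simp: swap_uv edge_iff side_uv link_uv u_eq_iff v_eq_iff N_eq b_eq algebra_simps)
  next
    case 7
    then show ?thesis
      by (auto simp: swap_uv E_eq)
  qed
qed

lemma swap_edge_vv_side:
  assumes "even i"
  shows "{swap (v i), swap (v (i + 1))} \<in> E"
proof -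
  \<comment> \<open>Parity removes the odd residues at which \<open>v i\<close> or
    \<open>v (i + 1)\<close> might be moved.\<close>
  have "i mod M \<noteq> M - 3" "i mod M \<noteq> M - 1" "i mod M \<noteq> 1"
    using even_residue[of i] even_M assms by auto
  then consider "i mod M = 0" | "i mod M = 2" | "i mod M = M - 2" | "2 < i mod M" "i mod M < M - 3"
    using residue_bounds[of i] by linarith
  then show ?thesis
  proof cases
    case 1
    then have "(i + 1) mod M = 1" using M_ge by (simp add: residue_add)
    then show ?thesis
      using 1 M_ge even_M assms
      by (auto simp: swap_uv edge_iff side_uv link_uv u_eq_iff v_eq_iff N_eq b_eq algebra_simps)
  next
    case 2
    then have "(i + 1) mod M = 3" using M_ge by (simp add: residue_add)
    then show ?thesis
      using 2 M_ge even_M assms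
      by (auto simp: swap_uv edge_iff side_uv link_uv u_eq_iff v_eq_iff N_eq b_eq algebra_simps)
  next
    case 3
    then have "(i + 1) mod M = M - 1" using M_ge by (simp add: residue_add)
    then show ?thesis
      using 3 M_ge even_M assms
      by (auto simp: swap_uv edge_iff side_uv link_uv u_eq_iff v_eq_iff N_eq b_eq algebra_simps)
  next
    case 4
    then have "(i + 1) mod M = i mod M + 1" using M_ge by (simp add: residue_add)
    then show ?thesis
      using 4 assms even_residue[of i] by (auto simp: swap_uv E_eq)
  qed
qed

text \<open>Modulo \<open>M\<close> the link adds 3, so for even \<open>i\<close> an end is moved
  only at the residues 0 and M - 2.\<close>

lemma swap_edge_vv_link:
  assumes "even i"
  shows "{swap (v i), swap (v (i + int b))} \<in> E"
proof -
  have r: "(i + int b) mod M = (i + 3) mod M"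
    using residue_shift[of "i + 3"] by (simp add: b_eq ac_simps)
  have "i mod M \<noteq> M - 3" "i mod M \<noteq> M - 1" "i mod M \<noteq> 1" "i mod M \<noteq> 3"
    using even_residue[of i] even_M assms by auto
  then consider "i mod M = 0" | "i mod M = M - 2" | "i mod M \<noteq> 0" "i mod M < M - 3"
    using residue_bounds[of i] by linarith
  then show "{swap (v i), swap (v (i + int b))} \<in> E"
  proof cases
    case 1
    then have "(i + int b) mod M = 3" using M_ge unfolding r by (simp add: residue_add)
    then show ?thesis
      using 1 M_ge assms even_M
      by (auto simp: swap_uv edge_iff side_uv link_uv u_eq_iff v_eq_iff N_eq b_eq algebra_simps)
  next
    case 2
    then have "(i + int b) mod M = 1" using M_ge unfolding r by (simp add: residue_add)
    then show ?thesis
      using 2 M_ge assms even_M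
      by (auto simp: swap_uv edge_iff side_uv link_uv u_eq_iff v_eq_iff N_eq b_eq algebra_simps)
  next
    case 3
    then have "(i + int b) mod M = i mod M + 3" using M_ge unfolding r by (simp add: residue_add)
    moreover have "i mod M \<noteq> M - 5" "i mod M \<noteq> 1" "i mod M \<noteq> 3"
      using even_residue[of i] even_M assms by auto
    ultimately show ?thesis
      using 3 residue_bounds[of i] assms
      by (simp add: swap_uv edge_iff link_uv)
  qed
qed

lemma swap_edge:
  assumes "{x, y} \<in> E" shows "{swap x, swap y} \<in> E"
proof -
  have "swap ` e \<in> E" if "e \<in> E" for e
    using that[unfolded E_eq] swap_edge_uu swap_edge_uv swap_edge_vv_side swap_edge_vv_link
    by (elim UnE imageE) simp_all
  from this[OF assms] show ?thesis by simp
qed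

lemma automorphism_swap: "automorphism X swap"
  by (rule automorphismI[where g = swap]) (simp_all add: swap_in_W swap_swap swap_edge)

lemma not_F12_invariant_X: "\<not> F12_invariant X"
proof -
  \<comment> \<open>The vertex \<open>u 3\<close> lies on the diagonal in which the square 1, a
    neighbour of the square 0, is reflected.\<close>
  have "3 mod M = 3" "2 mod M = 2" using M_ge by simp_all
  then have "swap (u 3) = u 3" "swap (v 3) = u 2" "swap (u 2) = v 3"
    using M_ge by (simp_all add: swap_uv)
  then have "\<not> composed_of_two_cycles X F2" if "invariant_12_partition X F1 F2" for F1 F2
    using automorphism_swap that
    by (intro not_two_cycles_if_swap[of swap "u 3"]) (simp_all add: side_uv)
  then show ?thesis unfolding F12_invariant_def by blast
qed

end

section \<open>Case distinction between exceptional and other parameters\<close>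

theorem theorem6p4:
  fixes n b :: nat
  assumes "n \<ge> 4" and "even n"
    and "odd b" and "3 < b" and "b < n - 2"
    and "gcd (b - 1) n = 2"
    and "[(b - 1)\<^sup>2 div 2 = 2] (mod n)"
  shows "F12_invariant (MO n 1 b) \<longleftrightarrow> \<not> ([n = 0] (mod 8) \<and> b = (n + 6) div 2)"
proof -
  interpret mo_graph n b
    using assms by unfold_locales
  show ?thesis
  proof (cases "[n = 0] (mod 8) \<and> b = (n + 6) div 2")
    case True
    then have "8 dvd n" "b = (n + 6) div 2" by (simp_all add: cong_0_iff)
    \<comment> \<open>The equation for \<open>b\<close> says that b - 3 is n / 2, which is even
      since 8 divides \<open>n\<close>; this is the \<open>M\<close> of the exceptional
      case.\<close>
    then have "int n = 2 * (int b - 3)" "even (int b - 3)" by presburger+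
    then interpret exceptional_mo_graph n b "int b - 3"
      by unfold_locales simp_all
    show ?thesis using True not_F12_invariant_X unfolding X_def by blast
  next
    case False
    then show ?thesis
      using F12_invariant_X exceptional_iff unfolding X_def by blast
  qed
qed

end
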